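(* Let $f(t),g(t)\in\mathbb{C}[[t]]$ be a delta series and an invertible series respectively, and let $r\ge 1$ be an integer. For every $n\ge0$, the Legendre-Gould Hopper based Sheffer polynomials ${}_{{}_{s}LeG^{(r)}}s_{n}(x,y,z)$ are obtained from the 2-variable Legendre-type based Sheffer polynomials ${}_{{}_2Leb}s_{n}(x,y)$ by $${}_{{}_{s}LeG^{(r)}}s_{n}(x,y,z)=\exp\!\left(z\frac{\partial^r}{\partial y^r}\right)\,{}_{{}_2Leb}s_{n}(x,y).$$
   Context: A delta series is $f\in\mathbb{C}[[t]]$ with $f(0)=0$, $f'(0)\neq 0$; $f^{-1}$ denotes its compositional inverse. An invertible series is $g\in\mathbb{C}[[t]]$ with $g(0)\ne 0$. $C_0(x)=\sum_{k\ge 0}\frac{(-1)^k x^k}{(k!)^2}$. The exponential of an operator is the formal exponential series, which acts as a locally finite sum on polynomials. The polynomials are determined by the generating functions $$\frac{1}{g(f^{-1}(t))}\,C_0\!\left(-x\,(f^{-1}(t))^2\right)\exp\!\left(y f^{-1}(t)+z\,(f^{-1}(t))^r\right)=\sum_{n=0}^{\infty}{}_{{}_{s}LeG^{(r)}}s_{n}(x,y,z)\frac{t^n}{n!},$$ $$\frac{1}{g(f^{-1}(t))}\,C_0\!\left(-x\,(f^{-1}(t))^2\right)\exp\!\left(y f^{-1}(t)\right)=\sum_{n=0}^{\infty}{}_{{}_2Leb}s_{n}(x,y)\frac{t^n}{n!}.$$ *)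

theory Defs
  imports
    Complex_Main
    "HOL-Library.Groups_Big_Fun"
    "HOL-Computational_Algebra.Computational_Algebra"
begin

section \<open>Delta series and invertible series\<close>

definition delta_series :: "complex fps \<Rightarrow> bool" where
  "delta_series f \<longleftrightarrow> fps_nth f 0 = 0 \<and> fps_nth (fps_deriv f) 0 \<noteq> 0"

definition invertible_series :: "complex fps \<Rightarrow> bool" where
  "invertible_series g \<longleftrightarrow> fps_nth g 0 \<noteq> 0"

definition C0 :: "complex fps" where
  "C0 = Abs_fps (\<lambda>k. (-1) ^ k / (fact k)\<^sup>2)"

section \<open>The polynomial rings\<close>

text \<open>
  The ring \<open>\<complex>[x,y]\<close> is modelled as \<open>\<complex>[x][y]\<close>, and \<open>\<complex>[x,y,z]\<close> as \<open>\<complex>[x][y][z]\<close>: the innermost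
  polynomial variable is \<open>x\<close>, the outermost one of a trivariate polynomial is \<open>z\<close>.
\<close>

type_synonym poly_xy = "complex poly poly"
type_synonym poly_xyz = "complex poly poly poly"

definition const2 :: "complex \<Rightarrow> poly_xy" where "const2 c = [:[:c:]:]"
definition X2 :: poly_xy where "X2 = [:[:0, 1:]:]"
definition Y2 :: poly_xy where "Y2 = [:0, 1:]"

definition embed_xy :: "poly_xy \<Rightarrow> poly_xyz" where "embed_xy p = [:p:]"
definition const3 :: "complex \<Rightarrow> poly_xyz" where "const3 c = embed_xy (const2 c)"
definition X3 :: poly_xyz where "X3 = embed_xy X2"
definition Y3 :: poly_xyz where "Y3 = embed_xy Y2"
definition Z3 :: poly_xyz where "Z3 = [:0, 1:]"

text \<open>
  \<open>pderiv\<close> on \<open>\<complex>[x][y]\<close> differentiates with respect to the outer variable \<open>y\<close>; on \<open>\<complex>[x][y][z]\<close> it is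
  applied to each coefficient of a power of \<open>z\<close>.
\<close>

definition partial_y :: "poly_xyz \<Rightarrow> poly_xyz" where
  "partial_y = map_poly pderiv"

text \<open>
  \<open>Sum_any\<close> sums over the (finite) set of indices with nonzero summand, so this is the formal
  exponential series acting as a locally finite sum; see \<open>finite_support_exp_z_partial_y\<close> below.
\<close>

definition op_exp :: "(poly_xyz \<Rightarrow> poly_xyz) \<Rightarrow> poly_xyz \<Rightarrow> poly_xyz" where
  "op_exp D p = Sum_any (\<lambda>k. const3 (1 / fact k) * (D ^^ k) p)"

section \<open>Generating functions\<close>

text \<open>
  The generating functions are power series in \<open>t\<close> over \<open>\<complex>[x,y]\<close> and \<open>\<complex>[x,y,z]\<close>. Series with complex
  coefficients are transported there coefficientwise.
\<close>

definition map_fps :: "('a \<Rightarrow> 'b) \<Rightarrow> 'a fps \<Rightarrow> 'b fps" where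
  "map_fps h F = Abs_fps (\<lambda>n. h (fps_nth F n))"

definition Leb_gf :: "complex fps \<Rightarrow> complex fps \<Rightarrow> poly_xy fps" where
  "Leb_gf f g =
    (let u = map_fps const2 (fps_inv f) in
      map_fps const2 (inverse (g oo fps_inv f))
      * (map_fps const2 C0 oo (- (fps_const X2 * u ^ 2)))
      * (map_fps const2 (fps_exp 1) oo (fps_const Y2 * u)))"

definition LeG_gf :: "nat \<Rightarrow> complex fps \<Rightarrow> complex fps \<Rightarrow> poly_xyz fps" where
  "LeG_gf r f g =
    (let u = map_fps const3 (fps_inv f) in
      map_fps const3 (inverse (g oo fps_inv f))
      * (map_fps const3 C0 oo (- (fps_const X3 * u ^ 2)))
      * (map_fps const3 (fps_exp 1) oo (fps_const Y3 * u + fps_const Z3 * u ^ r)))"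

definition Leb_sheffer :: "complex fps \<Rightarrow> complex fps \<Rightarrow> nat \<Rightarrow> poly_xy" where
  "Leb_sheffer f g n = fact n * fps_nth (Leb_gf f g) n"

definition LeG_sheffer :: "nat \<Rightarrow> complex fps \<Rightarrow> complex fps \<Rightarrow> nat \<Rightarrow> poly_xyz" where
  "LeG_sheffer r f g n = fact n * fps_nth (LeG_gf r f g) n"

section \<open>Sanity checks\<close>

lemma const2_fact: "const2 (1 / fact n) * fact n = 1"
proof -
  have "(fact n :: poly_xy) = const2 (fact n)"
    by (metis const2_def of_nat_fact of_nat_poly)
  then show ?thesis by (simp add: const2_def one_pCons)
qed

lemma const3_fact: "const3 (1 / fact n) * fact n = 1"
proof -
  have "(fact n :: poly_xyz) = [:fact n:]"
    by (metis of_nat_fact of_nat_poly)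
  then show ?thesis
    using const2_fact[of n] by (simp add: const3_def embed_xy_def one_pCons mult.commute)
qed

lemma Leb_gf_expansion:
  "Leb_gf f g = Abs_fps (\<lambda>n. const2 (1 / fact n) * Leb_sheffer f g n)"
  by (simp add: fps_eq_iff Leb_sheffer_def const2_fact flip: mult.assoc)

lemma LeG_gf_expansion:
  "LeG_gf r f g = Abs_fps (\<lambda>n. const3 (1 / fact n) * LeG_sheffer r f g n)"
  by (simp add: fps_eq_iff LeG_sheffer_def const3_fact flip: mult.assoc)

lemma partial_y_mult_Z3: "partial_y (Z3 * p) = Z3 * partial_y p"
  by (simp add: partial_y_def Z3_def map_poly_pCons)

lemma partial_y_pow_mult_Z3: "(partial_y ^^ m) (Z3 * p) = Z3 * (partial_y ^^ m) p"
  by (induction m) (simp_all add: partial_y_mult_Z3)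

lemma exp_z_partial_y_power:
  "((\<lambda>q. Z3 * (partial_y ^^ r) q) ^^ k) p = Z3 ^ k * (partial_y ^^ (r * k)) p"
proof (induction k)
  case (Suc k)
  have pull: "(partial_y ^^ m) (Z3 ^ k * q) = Z3 ^ k * (partial_y ^^ m) q" for m k q
    by (induction k arbitrary: q) (simp_all add: partial_y_pow_mult_Z3 mult.assoc)
  show ?case
    by (simp add: Suc pull funpow_add mult.assoc)
qed simp

lemma coeff_partial_y_pow: "coeff ((partial_y ^^ m) p) i = (pderiv ^^ m) (coeff p i)"
  by (induction m) (simp_all add: partial_y_def coeff_map_poly)

lemma finite_support_exp_z_partial_y:
  assumes "r \<ge> 1"
  shows "finite {k. const3 (1 / fact k) * ((\<lambda>q. Z3 * (partial_y ^^ r) q) ^^ k) (embed_xy p) \<noteq> 0}"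
proof (rule finite_subset)
  have vanish: "(partial_y ^^ (r * k)) (embed_xy p) = 0" if "k > degree p" for k
  proof (rule poly_eqI)
    fix i
    have "k \<le> r * k" using assms by simp
    then have "degree p < r * k" using that by linarith
    then have "(pderiv ^^ (r * k)) p = 0"
      by (intro poly_eqI) (simp add: coeff_higher_pderiv coeff_eq_0)
    moreover have "(pderiv ^^ m) (0 :: poly_xy) = 0" for m
      by (induction m) simp_all
    ultimately show "coeff ((partial_y ^^ (r * k)) (embed_xy p)) i = coeff 0 i"
      by (cases i) (simp_all add: coeff_partial_y_pow embed_xy_def)
  qed
  show "{k. const3 (1 / fact k) * ((\<lambda>q. Z3 * (partial_y ^^ r) q) ^^ k) (embed_xy p) \<noteq> 0} \<subseteq> {..degree p}"
    by (auto simp: exp_z_partial_y_power intro!: leI dest: vanish)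
qed simp

end

theory Submission
  imports Defs
begin

text \<open>
  Let \<open>u = f\<inverse>\<close> (compositional inverse) and let \<open>F(t)\<close> be the generating function of the
  bivariate family. Its only \<open>y\<close>-dependent factor is \<open>exp (y u)\<close>, so applying \<open>\<partial>/\<partial>y\<close>
  coefficientwise multiplies \<open>F\<close> by \<open>u\<close>. Hence \<open>exp (z \<partial>\<^sup>r/\<partial>y\<^sup>r)\<close> multiplies \<open>F\<close> by
  \<open>\<Sum>k. z\<^sup>k u\<^bsup>rk\<^esup> / k! = exp (z u\<^sup>r)\<close>, and \<open>exp (y u) exp (z u\<^sup>r) = exp (y u + z u\<^sup>r)\<close>.
\<close>

section \<open>Composition of formal power series\<close>

text \<open>Since \<open>b\<close> has no constant term, \<open>b ^ i\<close> has order at least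
  \<open>i\<close>, so terms with \<open>i > n\<close> contribute nothing. The free bound
  \<open>m\<close> leaves room for an index shift under differentiation.\<close>

lemma fps_mult_compose_nth:
  fixes F a b :: "'a :: comm_ring_1 fps"
  assumes "fps_nth b 0 = 0" and "n \<le> m"
  shows "fps_nth (F * (a oo b)) n = (\<Sum>i\<le>m. fps_nth a i * fps_nth (F * b ^ i) n)"
proof -
  \<comment> \<open>Padding every inner sum to the same range up to \<open>m\<close> lets the two
    sums be swapped.\<close>
  have comp: "fps_nth (a oo b) k = (\<Sum>i\<le>m. fps_nth a i * fps_nth (b ^ i) k)" if "k \<le> n" for k
    unfolding fps_compose_nth
    by (rule sum.mono_neutral_left)
      (use that assms in \<open>auto simp: startsby_zero_power_prefix\<close>)
  have "fps_nth (F * (a oo b)) n =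
      (\<Sum>j=0..n. \<Sum>i\<le>m. fps_nth a i * (fps_nth F j * fps_nth (b ^ i) (n - j)))"
    unfolding fps_mult_nth by (intro sum.cong refl) (simp add: comp sum_distrib_left ac_simps)
  also have "\<dots> = (\<Sum>i\<le>m. fps_nth a i * fps_nth (F * b ^ i) n)"
    by (subst sum.swap) (simp add: fps_mult_nth sum_distrib_left)
  finally show ?thesis .
qed

text \<open>The coefficient of t^k expresses (k+1) times the next coefficient through the earlier
  ones; the factor k+1 cancels in a domain of characteristic 0.\<close>

lemma fps_linear_ode_unique:
  fixes A B c :: "'a :: {idom, ring_char_0} fps"
  assumes "fps_deriv A = c * A" and "fps_deriv B = c * B" and "fps_nth A 0 = fps_nth B 0"
  shows "A = B"
proof (rule fps_ext)
  fix n show "fps_nth A n = fps_nth B n"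
  proof (induction n rule: less_induct)
    case (less n)
    show ?case
    proof (cases n)
      case (Suc k)
      have "of_nat (Suc k) * fps_nth A (Suc k) = fps_nth (c * A) k"
        by (simp flip: assms(1))
      also have "\<dots> = fps_nth (c * B) k"
        unfolding fps_mult_nth by (intro sum.cong refl) (simp add: less Suc)
      also have "\<dots> = of_nat (Suc k) * fps_nth B (Suc k)"
        by (simp flip: assms(2))
      finally show ?thesis
        unfolding Suc by (simp only: mult_cancel_left of_nat_eq_0_iff) simp
    qed (use assms(3) in simp)
  qed
qed

text \<open>Both sides solve Y' = (a' + b') Y with constant term 1. Polynomial coefficients do not
  form a field, so the exponential is characterized by E' = E and E(0) = 1.\<close>

lemma fps_exp_compose_add:
  fixes E a b :: "'a :: {idom, ring_char_0} fps"
  assumes "fps_deriv E = E" and "fps_nth a 0 = 0" and "fps_nth b 0 = 0" and "fps_nth E 0 = 1"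
  shows "E oo (a + b) = (E oo a) * (E oo b)"
  by (rule fps_linear_ode_unique[where c = "fps_deriv a + fps_deriv b"])
    (use assms in \<open>simp_all add: fps_compose_deriv algebra_simps\<close>)

section \<open>The embedding of \<open>\<complex>[x,y]\<close> into \<open>\<complex>[x,y,z]\<close>\<close>

lemma embed_xy_simps [simp]:
  "embed_xy 0 = 0" "embed_xy 1 = 1"
  "embed_xy (p + q) = embed_xy p + embed_xy q"
  "embed_xy (p * q) = embed_xy p * embed_xy q"
  "embed_xy (- p) = - embed_xy p"
  by (simp_all add: embed_xy_def one_pCons)

lemma embed_xy_sum: "embed_xy (sum h A) = (\<Sum>i\<in>A. embed_xy (h i))"
  by (induction A rule: infinite_finite_induct) simp_all

lemma embed_xy_fact: "embed_xy (fact n) = fact n"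
  by (metis embed_xy_def of_nat_fact of_nat_poly)

lemma map_fps_nth [simp]: "fps_nth (map_fps h F) n = h (fps_nth F n)"
  by (simp add: map_fps_def)

lemma map_fps_embed_mult:
  "map_fps embed_xy (A * B) = map_fps embed_xy A * map_fps embed_xy B"
  by (rule fps_ext) (simp add: fps_mult_nth embed_xy_sum)

lemma map_fps_embed_power: "map_fps embed_xy (A ^ k) = map_fps embed_xy A ^ k"
proof (induction k)
  case 0
  show ?case by (rule fps_ext) simp
qed (simp add: map_fps_embed_mult)

text \<open>Each coefficient of a composition is a finite sum of products, which the ring
  homomorphism \<open>embed_xy\<close> respects.\<close>

lemma map_fps_embed_compose:
  "map_fps embed_xy (A oo B) = map_fps embed_xy A oo map_fps embed_xy B"
  by (rule fps_ext) (simp add: fps_compose_nth embed_xy_sum flip: map_fps_embed_power)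

lemma map_fps_embed_uminus: "map_fps embed_xy (- A) = - map_fps embed_xy A"
  by (rule fps_ext) simp

lemma map_fps_embed_const: "map_fps embed_xy (fps_const c) = fps_const (embed_xy c)"
  by (rule fps_ext) simp

lemma map_fps_embed_const2: "map_fps embed_xy (map_fps const2 A) = map_fps const3 A"
  by (rule fps_ext) (simp add: const3_def)

lemmas map_fps_embed =
  map_fps_embed_mult map_fps_embed_power map_fps_embed_compose map_fps_embed_uminus
  map_fps_embed_const map_fps_embed_const2

section \<open>Coefficientwise differentiation with respect to \<open>y\<close>\<close>

lemma pderiv_sum: "pderiv (sum h A) = (\<Sum>i\<in>A. pderiv (h i))"
  by (induction A rule: infinite_finite_induct) (simp_all add: pderiv_add)

lemma map_fps_pderiv_mult:
  fixes A B :: "'a :: idom poly fps"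
  shows "map_fps pderiv (A * B) = A * map_fps pderiv B + map_fps pderiv A * B"
  by (rule fps_ext)
    (simp add: fps_mult_nth pderiv_sum pderiv_mult sum.distrib mult.commute[of "fps_nth B _"])

lemma map_fps_pderiv_power_eq_0:
  fixes A :: "'a :: idom poly fps"
  assumes "map_fps pderiv A = 0"
  shows "map_fps pderiv (A ^ k) = 0"
proof (induction k)
  case 0
  show ?case by (rule fps_ext) simp
qed (simp add: map_fps_pderiv_mult assms)

lemma map_fps_pderiv_compose_eq_0:
  fixes A B :: "'a :: idom poly fps"
  assumes "map_fps pderiv A = 0" and "map_fps pderiv B = 0"
  shows "map_fps pderiv (A oo B) = 0"
proof (rule fps_ext)
  fix n
  have "pderiv (fps_nth A i) = 0" "pderiv (fps_nth (B ^ i) n) = 0" for i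
    using assms map_fps_pderiv_power_eq_0[of B i] by (auto simp: fps_eq_iff)
  then show "fps_nth (map_fps pderiv (A oo B)) n = fps_nth 0 n"
    by (simp add: fps_compose_nth pderiv_sum pderiv_mult)
qed

lemma map_fps_pderiv_const2: "map_fps pderiv (map_fps const2 A) = 0"
  by (rule fps_ext) (simp add: const2_def pderiv_pCons)

lemma const2_inverse_fact_Suc: "const2 (1 / fact (Suc i)) * of_nat (Suc i) = const2 (1 / fact i)"
proof -
  have "(of_nat (Suc i) :: poly_xy) = const2 (of_nat (Suc i))"
    by (metis const2_def of_nat_poly)
  then show ?thesis
    by (simp add: const2_def del: of_nat_Suc)
qed

text \<open>With \<open>u\<close> constant in y, the y-derivative of (y u)^(i+1) / (i+1)! is u (y
  u)^i / i!; the proof sums this over i.\<close>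

lemma map_fps_pderiv_exp_Y:
  assumes "map_fps pderiv u = 0" and "fps_nth u 0 = 0"
  shows "map_fps pderiv (map_fps const2 (fps_exp 1) oo (fps_const Y2 * u))
    = u * (map_fps const2 (fps_exp 1) oo (fps_const Y2 * u))"
proof (rule fps_ext)
  fix n
  let ?c = "\<lambda>i. const2 (1 / fact i)"
  have coeff: "fps_nth ((fps_const Y2 * u) ^ i) n = Y2 ^ i * fps_nth (u ^ i) n" for i n
    by (simp add: power_mult_distrib)
  have const_c: "pderiv (?c i) = 0" for i
    by (simp add: const2_def pderiv_pCons)
  have const_u: "pderiv (fps_nth (u ^ i) n) = 0" for i
    using map_fps_pderiv_power_eq_0[OF assms(1), of i] by (auto simp: fps_eq_iff)
  have "pderiv Y2 = 1"
    by (simp add: Y2_def pderiv_pCons one_pCons)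
  then have deriv_pow: "pderiv (Y2 ^ Suc i) = of_nat (Suc i) * Y2 ^ i" for i
    by (simp only: pderiv_power_Suc of_nat_poly smult_eq_iff) (simp add: of_nat_poly)
  \<comment> \<open>The sum runs to \<open>Suc n\<close> because differentiation kills the term i =
    0, and the shifted sum must still reach \<open>n\<close>.\<close>
  have "fps_nth (map_fps const2 (fps_exp 1) oo (fps_const Y2 * u)) n
      = (\<Sum>i\<le>Suc n. ?c i * (Y2 ^ i * fps_nth (u ^ i) n))"
    using fps_mult_compose_nth[of "fps_const Y2 * u" n "Suc n" 1 "map_fps const2 (fps_exp 1)"]
      assms(2) by (simp only: mult_1 coeff) simp
  then have "fps_nth (map_fps pderiv (map_fps const2 (fps_exp 1) oo (fps_const Y2 * u))) n
      = (\<Sum>i\<le>Suc n. ?c i * (pderiv (Y2 ^ i) * fps_nth (u ^ i) n))"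
    by (simp only: map_fps_nth pderiv_sum pderiv_mult const_c const_u)
      (simp add: mult.commute)
  also have "\<dots> = (\<Sum>i\<le>n. ?c (Suc i) * (pderiv (Y2 ^ Suc i) * fps_nth (u ^ Suc i) n))"
    by (subst sum.atMost_Suc_shift) simp
  also have "\<dots> = (\<Sum>i\<le>n. ?c i * (Y2 ^ i * fps_nth (u ^ Suc i) n))"
    by (intro sum.cong refl) (metis deriv_pow const2_inverse_fact_Suc mult.assoc)
  also have "\<dots> = (\<Sum>i\<le>n. ?c i * fps_nth (u * (fps_const Y2 * u) ^ i) n)"
    by (simp add: power_mult_distrib mult.left_commute[of u "fps_const c" for c])
  also have "\<dots> = fps_nth (u * (map_fps const2 (fps_exp 1) oo (fps_const Y2 * u))) n"
    using assms(2) by (subst fps_mult_compose_nth[of _ n n]) auto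
  finally show "fps_nth (map_fps pderiv (map_fps const2 (fps_exp 1) oo (fps_const Y2 * u))) n
    = fps_nth (u * (map_fps const2 (fps_exp 1) oo (fps_const Y2 * u))) n" .
qed

section \<open>The generating functions\<close>

lemma fps_inv_nth_0 [simp]: "fps_nth (fps_inv f) 0 = 0"
  by (simp add: fps_inv_def)

lemma const_0 [simp]: "const2 0 = 0" "const3 0 = 0"
  by (simp_all add: const2_def const3_def)

lemma map_fps_pderiv_Leb_gf:
  "map_fps pderiv (Leb_gf f g) = map_fps const2 (fps_inv f) * Leb_gf f g"
proof -
  define u where "u = map_fps const2 (fps_inv f)"
  have u: "map_fps pderiv u = 0" "fps_nth u 0 = 0"
    by (simp_all add: u_def map_fps_pderiv_const2)
  \<comment> \<open>\<open>X2\<close> comes from the coefficient ring \<complex>[x], so the argument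
    of \<open>C0\<close> is constant in y.\<close>
  have "map_fps pderiv (- (fps_const X2 * u ^ 2)) = 0"
  proof (rule fps_ext)
    fix n
    have "pderiv (fps_nth (u ^ 2) n) = 0"
      using map_fps_pderiv_power_eq_0[OF u(1), of 2] by (auto simp: fps_eq_iff)
    then show "fps_nth (map_fps pderiv (- (fps_const X2 * u ^ 2))) n = fps_nth 0 n"
      by (simp add: pderiv_minus X2_def pderiv_smult)
  qed
  then have "map_fps pderiv (map_fps const2 C0 oo (- (fps_const X2 * u ^ 2))) = 0"
    by (intro map_fps_pderiv_compose_eq_0 map_fps_pderiv_const2)
  then show ?thesis
    by (simp add: Leb_gf_def Let_def u_def[symmetric] map_fps_pderiv_mult map_fps_pderiv_const2
        map_fps_pderiv_exp_Y[OF u] mult.assoc mult.left_commute[of u])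
qed

text \<open>Powers of \<open>u\<close> are constant in y, so each further derivative falls on the
  generating function alone and yields one more factor \<open>u\<close>.\<close>

lemma funpow_pderiv_Leb_gf_nth:
  "(pderiv ^^ m) (fps_nth (Leb_gf f g) n) = fps_nth (map_fps const2 (fps_inv f) ^ m * Leb_gf f g) n"
proof (induction m)
  case (Suc m)
  have "(pderiv ^^ Suc m) (fps_nth (Leb_gf f g) n)
      = fps_nth (map_fps pderiv (map_fps const2 (fps_inv f) ^ m * Leb_gf f g)) n"
    by (simp add: Suc)
  then show ?case
    by (simp add: map_fps_pderiv_mult map_fps_pderiv_Leb_gf map_fps_pderiv_const2
        map_fps_pderiv_power_eq_0 mult_ac)
qed simp

lemma funpow_partial_y_embed: "(partial_y ^^ m) (embed_xy p) = embed_xy ((pderiv ^^ m) p)"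
  by (induction m) (simp_all add: partial_y_def embed_xy_def map_poly_pCons)

lemma funpow_pderiv_fact_mult:
  fixes p :: "'a :: {idom, ring_char_0} poly"
  shows "(pderiv ^^ m) (fact n * p) = fact n * (pderiv ^^ m) p"
proof (induction m)
  case (Suc m)
  have "pderiv (fact n :: 'a poly) = 0"
    by (metis of_nat_fact of_nat_poly pderiv_singleton)
  then show ?case
    by (simp add: Suc pderiv_mult)
qed simp

lemma fps_deriv_const3_exp:
  "fps_deriv (map_fps const3 (fps_exp 1)) = map_fps const3 (fps_exp 1)"
proof (rule fps_ext)
  fix n
  have "(of_nat (Suc n) :: poly_xyz) = embed_xy (of_nat (Suc n))"
    by (metis embed_xy_def of_nat_poly)
  then show "fps_nth (fps_deriv (map_fps const3 (fps_exp 1))) n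
      = fps_nth (map_fps const3 (fps_exp 1)) n"
    using arg_cong[OF const2_inverse_fact_Suc[of n], of embed_xy]
    by (simp add: const3_def mult.commute del: of_nat_Suc fact_Suc)
qed

text \<open>For r at least 1 the series z u^r has no constant term, so the exponential of y u + z
  u^r splits; all factors free of z are images under \<open>embed_xy\<close>.\<close>

lemma LeG_gf_eq:
  assumes "r \<ge> 1"
  shows "LeG_gf r f g = map_fps embed_xy (Leb_gf f g)
    * (map_fps const3 (fps_exp 1) oo (fps_const Z3 * map_fps const3 (fps_inv f) ^ r))"
proof -
  have "const3 1 = 1"
    by (simp add: const3_def const2_def embed_xy_def one_pCons)
  then show ?thesis
    using assms
    by (simp add: LeG_gf_def Leb_gf_def Let_def map_fps_embed X3_def Y3_def
        fps_exp_compose_add fps_deriv_const3_exp mult.assoc)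
qed

theorem theorem4p2:
  fixes f g :: "complex fps" and r n :: nat
  assumes "delta_series f" and "invertible_series g" and "r \<ge> 1"
  shows "LeG_sheffer r f g n =
    op_exp (\<lambda>q. Z3 * (partial_y ^^ r) q) (embed_xy (Leb_sheffer f g n))"
proof -
  define u where "u = map_fps const3 (fps_inv f)"
  define F where "F = map_fps embed_xy (Leb_gf f g)"
  have u0: "fps_nth u 0 = 0"
    by (simp add: u_def)
  \<comment> \<open>The k-th term of the operator exponential is, up to \<open>fact n\<close>, the
    k-th term in the expansion of F exp(z u^r).\<close>
  have summand: "const3 (1 / fact k)
      * ((\<lambda>q. Z3 * (partial_y ^^ r) q) ^^ k) (embed_xy (Leb_sheffer f g n))
    = fact n * (const3 (1 / fact k) * fps_nth (F * (fps_const Z3 * u ^ r) ^ k) n)" for k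
  proof -
    have "fps_nth (map_fps embed_xy (map_fps const2 (fps_inv f) ^ m * Leb_gf f g)) n
        = fps_nth (u ^ m * F) n" for m
      unfolding u_def F_def by (simp only: map_fps_embed)
    then have "(partial_y ^^ m) (embed_xy (Leb_sheffer f g n))
        = fact n * fps_nth (u ^ m * F) n" for m
      unfolding Leb_sheffer_def funpow_partial_y_embed funpow_pderiv_fact_mult
        funpow_pderiv_Leb_gf_nth
      by (simp add: embed_xy_fact)
    moreover have "F * (fps_const Z3 * u ^ r) ^ k = fps_const (Z3 ^ k) * (u ^ (r * k) * F)"
      by (simp add: power_mult_distrib mult_ac flip: power_mult)
    ultimately show ?thesis
      by (simp only: exp_z_partial_y_power fps_mult_left_const_nth mult.left_commute[of "fact n"])
  qed
  \<comment> \<open>As r is at least 1, z u^r has order at least 1 and its k-th power order at least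
    k. This cuts \<open>Sum_any\<close> down to the indices up to \<open>n\<close>.\<close>
  have vanish: "fps_nth (F * (fps_const Z3 * u ^ r) ^ k) n = 0" if "k > n" for k
  proof -
    have "fps_nth ((fps_const Z3 * u ^ r) ^ k) j = 0" if "j \<le> n" for j
      using u0 assms(3) that \<open>k > n\<close> by (intro startsby_zero_power_prefix[rule_format]) auto
    then show ?thesis
      by (simp add: fps_mult_nth)
  qed
  have "op_exp (\<lambda>q. Z3 * (partial_y ^^ r) q) (embed_xy (Leb_sheffer f g n))
      = (\<Sum>k\<le>n. fact n * (const3 (1 / fact k) * fps_nth (F * (fps_const Z3 * u ^ r) ^ k) n))"
    unfolding op_exp_def summand
    by (rule Sum_any.expand_superset) (auto simp: vanish intro!: leI)
  also have "\<dots> = fact n * fps_nth (F * (map_fps const3 (fps_exp 1) oo (fps_const Z3 * u ^ r))) n"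
    using u0 assms(3) by (subst fps_mult_compose_nth[of _ n n]) (auto simp: sum_distrib_left)
  also have "\<dots> = LeG_sheffer r f g n"
    by (simp add: LeG_sheffer_def LeG_gf_eq[OF assms(3)] F_def u_def)
  finally show ?thesis by simp
qed

end
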